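(* Let $C$ be a program, $f\in\mathbb E^\star$, $\sigma\in\Sigma$ with $\mathsf{wp}[C](|f|)(\sigma)<\infty$, and $\widetilde{\mathsf{wp}}[C]\,[(f,|f|)]_{\approx}=[(f',g')]_{\approx}$. Then $f'(\sigma)$ is the expected value of $f$ after termination of $C$ on initial state $\sigma$, i.e.\ if $f=f^+-f^-$ with $f^+=\lambda\sigma.\max\{0,f(\sigma)\}$ and $f^-=\lambda\sigma.-\min\{0,f(\sigma)\}$, then $f'(\sigma)=\mathsf{wp}[C](f^+)(\sigma)-\mathsf{wp}[C](f^-)(\sigma)$.
   Context: Programs: $C::=\mathtt{skip}\mid x:=E\mid C;C\mid \mathtt{if}(\xi)\{C\}\mathtt{else}\{C\}\mid\mathtt{while}(\xi)\{C\}$ over states $\Sigma$, guards interpreted as $p_\xi:\Sigma\to[0,1]$. $\mathbb{E}_{\geq0}^{\infty}=\{\Sigma\to[0,\infty]\}$, $\mathbb E^\star=\{\Sigma\to\mathbb R\}$. Standard $\mathsf{wp}[C]$ on $\mathbb{E}_{\geq0}^{\infty}$ (giving, for $h\ge0$, the expected value of $h$ after termination of $C$): skip identity, $x:=E$ substitution, sequencing composition, conditional $p_\xi\cdot\mathsf{wp}[C_1](h)+(1-p_\xi)\cdot\mathsf{wp}[C_2](h)$, loop $\mathrm{lfp}\,X.\,(1-p_\xi)\cdot h+p_\xi\cdot\mathsf{wp}[C'](X)$. $(f,g)\approx(f',g')$ iff for all $\sigma$, ($g(\sigma)\ne\infty$ or $g'(\sigma)\ne\infty$) implies $f(\sigma)=f'(\sigma)$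 and $g(\sigma)=g'(\sigma)$; $[(f,g)]_\approx$ the equivalence class, $\mathbb{IE}$ the set of classes of pairs with $|f|\le g$, $g\in\mathbb{E}_{\geq0}^{\infty}$. The mixed-sign transformer $\widetilde{\mathsf{wp}}[C]:\mathbb{IE}\to\mathbb{IE}$: skip identity; assignment substitutes in both components; sequencing composes; conditional $p_\xi\cdot\widetilde{\mathsf{wp}}[C_1][(f,g)]_\approx+(1-p_\xi)\cdot\widetilde{\mathsf{wp}}[C_2][(f,g)]_\approx$ with $(f,g)+(f',g')=(f+f',g+g')$, $h\cdot(f,g)=(hf,|h|g)$; loop $\lim_{n\to\omega}\Psi^n([(\mathbf0,\mathbf0)]_\approx)$ with $\Psi([(X,Y)]_\approx)=(1-p_\xi)\cdot[(f,g)]_\approx+p_\xi\cdot\widetilde{\mathsf{wp}}[C'][(X,Y)]_\approx$. *)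

theory Defs
  imports "HOL-Analysis.Analysis"
begin

type_synonym ('v, 'a) state = "'v \<Rightarrow> 'a"

text \<open>
  Expressions and guards are embedded semantically: an expression is a function of the state,
  and a guard \<open>\<xi>\<close> is identified with its interpretation, a function from states to \<open>[0,1]\<close>.
\<close>

typedef 's guard = "{p :: 's \<Rightarrow> real. \<forall>\<sigma>. 0 \<le> p \<sigma> \<and> p \<sigma> \<le> 1}"
  morphisms prob Guard
  by (intro exI[of _ "\<lambda>_. 0"]) simp

datatype ('v, 'a) prog =
    Skip
  | Assign 'v "('v, 'a) state \<Rightarrow> 'a"
  | Seq "('v, 'a) prog" "('v, 'a) prog"
  | Cond "('v, 'a) state guard" "('v, 'a) prog" "('v, 'a) prog"
  | While "('v, 'a) state guard" "('v, 'a) prog"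

primrec wp :: "('v, 'a) prog \<Rightarrow> (('v, 'a) state \<Rightarrow> ennreal) \<Rightarrow> ('v, 'a) state \<Rightarrow> ennreal" where
  "wp Skip h = h"
| "wp (Assign x E) h = (\<lambda>\<sigma>. h (\<sigma>(x := E \<sigma>)))"
| "wp (Seq C1 C2) h = wp C1 (wp C2 h)"
| "wp (Cond \<xi> C1 C2) h =
     (\<lambda>\<sigma>. ennreal (prob \<xi> \<sigma>) * wp C1 h \<sigma> + ennreal (1 - prob \<xi> \<sigma>) * wp C2 h \<sigma>)"
| "wp (While \<xi> C) h =
     lfp (\<lambda>X \<sigma>. ennreal (1 - prob \<xi> \<sigma>) * h \<sigma> + ennreal (prob \<xi> \<sigma>) * wp C X \<sigma>)"

type_synonym 's epair = "('s \<Rightarrow> real) \<times> ('s \<Rightarrow> ennreal)"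

definition iw_pair :: "'s epair \<Rightarrow> bool" where
  "iw_pair P \<longleftrightarrow> (\<forall>\<sigma>. ennreal \<bar>fst P \<sigma>\<bar> \<le> snd P \<sigma>)"

definition epair_equiv :: "'s epair \<Rightarrow> 's epair \<Rightarrow> bool" (infix "\<approx>\<^sub>w" 50) where
  "P \<approx>\<^sub>w Q \<longleftrightarrow>
     (\<forall>\<sigma>. snd P \<sigma> \<noteq> \<infinity> \<or> snd Q \<sigma> \<noteq> \<infinity> \<longrightarrow> fst P \<sigma> = fst Q \<sigma> \<and> snd P \<sigma> = snd Q \<sigma>)"

definition iw_rel :: "'s epair \<Rightarrow> 's epair \<Rightarrow> bool" where
  "iw_rel P Q \<longleftrightarrow> iw_pair P \<and> iw_pair Q \<and> P \<approx>\<^sub>w Q"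

lemma snd_eq_of_equiv: "P \<approx>\<^sub>w Q \<Longrightarrow> snd P = snd Q"
  unfolding epair_equiv_def by (metis ext)

lemma fst_eq_of_equiv: "P \<approx>\<^sub>w Q \<Longrightarrow> snd P \<sigma> \<noteq> \<infinity> \<Longrightarrow> fst P \<sigma> = fst Q \<sigma>"
  unfolding epair_equiv_def by blast

lemma epair_equivI:
  "snd P = snd Q \<Longrightarrow> (\<And>\<sigma>. snd P \<sigma> \<noteq> \<infinity> \<Longrightarrow> fst P \<sigma> = fst Q \<sigma>) \<Longrightarrow> P \<approx>\<^sub>w Q"
  unfolding epair_equiv_def by auto

lemma part_equivp_iw_rel: "part_equivp iw_rel"
proof (rule part_equivpI)
  show "\<exists>P :: 's epair. iw_rel P P"
    by (rule exI[of _ "(\<lambda>_. 0, \<lambda>_. 0)"]) (simp add: iw_rel_def iw_pair_def epair_equiv_def)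
  show "symp (iw_rel :: 's epair \<Rightarrow> 's epair \<Rightarrow> bool)"
    by (rule sympI) (auto simp: iw_rel_def epair_equiv_def)
  show "transp (iw_rel :: 's epair \<Rightarrow> 's epair \<Rightarrow> bool)"
    by (rule transpI) (simp add: iw_rel_def epair_equiv_def, metis)
qed

text \<open>
  The quotient is partial: its elements are the classes of those pairs \<open>(f, g)\<close> with
  \<open>\<bar>f\<bar> \<le> g\<close>, and \<open>ie_class\<close> is meaningful on such pairs only.
\<close>

quotient_type 's ie = "'s epair" / partial: iw_rel
  morphisms rep_ie ie_class
  by (rule part_equivp_iw_rel)

lift_definition ie_zero :: "'s ie" is "(\<lambda>_. 0, \<lambda>_. 0)"
  by (simp add: iw_rel_def iw_pair_def epair_equiv_def)

lift_definition ie_add :: "'s ie \<Rightarrow> 's ie \<Rightarrow> 's ie" is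
  "\<lambda>P Q. (\<lambda>\<sigma>. fst P \<sigma> + fst Q \<sigma>, \<lambda>\<sigma>. snd P \<sigma> + snd Q \<sigma>)"
proof -
  fix P P' Q Q' :: "'s epair"
  assume P: "iw_rel P P'" and Q: "iw_rel Q Q'"
  have bound: "iw_pair (\<lambda>\<sigma>. fst A \<sigma> + fst B \<sigma>, \<lambda>\<sigma>. snd A \<sigma> + snd B \<sigma>)"
    if "iw_pair A" "iw_pair B" for A B :: "'s epair"
    unfolding iw_pair_def
  proof
    fix \<sigma>
    have "ennreal \<bar>fst A \<sigma> + fst B \<sigma>\<bar> \<le> ennreal (\<bar>fst A \<sigma>\<bar> + \<bar>fst B \<sigma>\<bar>)"
      by (rule ennreal_leI) (rule abs_triangle_ineq)
    also have "\<dots> = ennreal \<bar>fst A \<sigma>\<bar> + ennreal \<bar>fst B \<sigma>\<bar>"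
      by (simp add: ennreal_plus)
    also have "\<dots> \<le> snd A \<sigma> + snd B \<sigma>"
      using that by (auto simp: iw_pair_def intro: add_mono)
    finally show "ennreal \<bar>fst (\<lambda>\<sigma>. fst A \<sigma> + fst B \<sigma>, \<lambda>\<sigma>. snd A \<sigma> + snd B \<sigma>) \<sigma>\<bar>
        \<le> snd (\<lambda>\<sigma>. fst A \<sigma> + fst B \<sigma>, \<lambda>\<sigma>. snd A \<sigma> + snd B \<sigma>) \<sigma>"
      by simp
  qed
  show "iw_rel (\<lambda>\<sigma>. fst P \<sigma> + fst Q \<sigma>, \<lambda>\<sigma>. snd P \<sigma> + snd Q \<sigma>)
      (\<lambda>\<sigma>. fst P' \<sigma> + fst Q' \<sigma>, \<lambda>\<sigma>. snd P' \<sigma> + snd Q' \<sigma>)"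
    using P Q bound unfolding iw_rel_def
    by (auto intro!: epair_equivI simp: snd_eq_of_equiv fst_eq_of_equiv)
qed

lift_definition ie_scale :: "('s \<Rightarrow> real) \<Rightarrow> 's ie \<Rightarrow> 's ie" is
  "\<lambda>h P. (\<lambda>\<sigma>. h \<sigma> * fst P \<sigma>, \<lambda>\<sigma>. ennreal \<bar>h \<sigma>\<bar> * snd P \<sigma>)"
proof -
  fix h :: "'s \<Rightarrow> real" and P P' :: "'s epair"
  assume P: "iw_rel P P'"
  have bound: "iw_pair (\<lambda>\<sigma>. h \<sigma> * fst A \<sigma>, \<lambda>\<sigma>. ennreal \<bar>h \<sigma>\<bar> * snd A \<sigma>)"
    if "iw_pair A" for A :: "'s epair"
    using that by (auto simp: iw_pair_def abs_mult ennreal_mult intro: mult_left_mono)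
  have "h \<sigma> * fst P \<sigma> = h \<sigma> * fst P' \<sigma>" if "ennreal \<bar>h \<sigma>\<bar> * snd P \<sigma> \<noteq> \<infinity>" for \<sigma>
    using that P fst_eq_of_equiv[of P P' \<sigma>]
    by (cases "h \<sigma> = 0") (auto simp: iw_rel_def ennreal_mult_eq_top_iff)
  then show "iw_rel (\<lambda>\<sigma>. h \<sigma> * fst P \<sigma>, \<lambda>\<sigma>. ennreal \<bar>h \<sigma>\<bar> * snd P \<sigma>)
      (\<lambda>\<sigma>. h \<sigma> * fst P' \<sigma>, \<lambda>\<sigma>. ennreal \<bar>h \<sigma>\<bar> * snd P' \<sigma>)"
    using P bound unfolding iw_rel_def
    by (intro conjI epair_equivI) (auto simp: snd_eq_of_equiv)
qed

lift_definition ie_subst :: "('s \<Rightarrow> 's) \<Rightarrow> 's ie \<Rightarrow> 's ie" is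
  "\<lambda>u P. (\<lambda>\<sigma>. fst P (u \<sigma>), \<lambda>\<sigma>. snd P (u \<sigma>))"
  by (simp add: iw_rel_def iw_pair_def epair_equiv_def)

text \<open>
  Limits are taken pointwise and componentwise. Where the limit of the second components is
  infinite, the first component of the limit is irrelevant up to \<open>\<approx>\<^sub>w\<close>, and nothing is required
  of it. Elsewhere the second components are eventually finite, so that the first components
  are eventually independent of the chosen representatives.
\<close>

lift_definition ie_tendsto :: "(nat \<Rightarrow> 's ie) \<Rightarrow> 's ie \<Rightarrow> bool" is
  "\<lambda>S L. \<forall>\<sigma>. (\<lambda>n. snd (S n) \<sigma>) \<longlonglongrightarrow> snd L \<sigma> \<and>
            (snd L \<sigma> \<noteq> \<infinity> \<longrightarrow> (\<lambda>n. fst (S n) \<sigma>) \<longlonglongrightarrow> fst L \<sigma>)"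
proof -
  fix S S' :: "nat \<Rightarrow> 's epair" and L L' :: "'s epair"
  assume "\<And>n. iw_rel (S n) (S' n)" and L: "iw_rel L L'"
  then have S: "S n \<approx>\<^sub>w S' n" for n
    by (simp add: iw_rel_def)
  have L: "L \<approx>\<^sub>w L'"
    using L by (simp add: iw_rel_def)
  have snds: "snd (S n) = snd (S' n)" "snd L = snd L'" for n
    using S L by (auto simp: snd_eq_of_equiv)
  have fsts: "((\<lambda>n. fst (S n) \<sigma>) \<longlonglongrightarrow> fst L \<sigma>) = ((\<lambda>n. fst (S' n) \<sigma>) \<longlonglongrightarrow> fst L' \<sigma>)"
    if lim: "(\<lambda>n. snd (S' n) \<sigma>) \<longlonglongrightarrow> snd L' \<sigma>" and fin: "snd L' \<sigma> \<noteq> \<infinity>" for \<sigma>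
  proof -
    have "snd L' \<sigma> < top"
      using fin by (simp add: top.not_eq_extremum)
    then have "eventually (\<lambda>n. snd (S' n) \<sigma> < top) sequentially"
      by (rule order_tendstoD(2)[OF lim])
    then have "eventually (\<lambda>n. fst (S n) \<sigma> = fst (S' n) \<sigma>) sequentially"
      by eventually_elim (use S snds in \<open>auto intro!: fst_eq_of_equiv\<close>)
    then have "((\<lambda>n. fst (S n) \<sigma>) \<longlonglongrightarrow> fst L \<sigma>) = ((\<lambda>n. fst (S' n) \<sigma>) \<longlonglongrightarrow> fst L \<sigma>)"
      by (rule tendsto_cong)
    moreover have "fst L \<sigma> = fst L' \<sigma>"
      using fin L snds by (auto intro!: fst_eq_of_equiv)
    ultimately show ?thesis by simp
  qed
  show "(\<forall>\<sigma>. (\<lambda>n. snd (S n) \<sigma>) \<longlonglongrightarrow> snd L \<sigma> \<and>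
            (snd L \<sigma> \<noteq> \<infinity> \<longrightarrow> (\<lambda>n. fst (S n) \<sigma>) \<longlonglongrightarrow> fst L \<sigma>)) =
        (\<forall>\<sigma>. (\<lambda>n. snd (S' n) \<sigma>) \<longlonglongrightarrow> snd L' \<sigma> \<and>
            (snd L' \<sigma> \<noteq> \<infinity> \<longrightarrow> (\<lambda>n. fst (S' n) \<sigma>) \<longlonglongrightarrow> fst L' \<sigma>))"
    using fsts by (auto simp: snds)
qed

lemma ie_tendsto_unique: "ie_tendsto S L \<Longrightarrow> ie_tendsto S L' \<Longrightarrow> L = L'"
proof transfer
  fix S :: "nat \<Rightarrow> 's epair" and L L' :: "'s epair"
  assume rel: "iw_rel L L" "iw_rel L' L'"
  assume L: "\<forall>\<sigma>. (\<lambda>n. snd (S n) \<sigma>) \<longlonglongrightarrow> snd L \<sigma> \<and>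
            (snd L \<sigma> \<noteq> \<infinity> \<longrightarrow> (\<lambda>n. fst (S n) \<sigma>) \<longlonglongrightarrow> fst L \<sigma>)"
    and L': "\<forall>\<sigma>. (\<lambda>n. snd (S n) \<sigma>) \<longlonglongrightarrow> snd L' \<sigma> \<and>
            (snd L' \<sigma> \<noteq> \<infinity> \<longrightarrow> (\<lambda>n. fst (S n) \<sigma>) \<longlonglongrightarrow> fst L' \<sigma>)"
  have snds: "snd L = snd L'"
    using L L' by (intro ext) (blast intro: LIMSEQ_unique)
  have "L \<approx>\<^sub>w L'"
    using L L' snds by (intro epair_equivI) (auto intro: LIMSEQ_unique)
  then show "iw_rel L L'"
    using rel by (simp add: iw_rel_def)
qed

text \<open>
  A sequence need not have a limit in general. The iterates arising from loops below do: their
  second components increase, and the increments of the first are dominated by those of the second.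
\<close>

definition ie_lim :: "(nat \<Rightarrow> 's ie) \<Rightarrow> 's ie" where
  "ie_lim S = (THE L. ie_tendsto S L)"

primrec wpm :: "('v, 'a) prog \<Rightarrow> ('v, 'a) state ie \<Rightarrow> ('v, 'a) state ie" where
  "wpm Skip F = F"
| "wpm (Assign x E) F = ie_subst (\<lambda>\<sigma>. \<sigma>(x := E \<sigma>)) F"
| "wpm (Seq C1 C2) F = wpm C1 (wpm C2 F)"
| "wpm (Cond \<xi> C1 C2) F =
     ie_add (ie_scale (prob \<xi>) (wpm C1 F)) (ie_scale (\<lambda>\<sigma>. 1 - prob \<xi> \<sigma>) (wpm C2 F))"
| "wpm (While \<xi> C) F =
     ie_lim (\<lambda>n. ((\<lambda>X. ie_add (ie_scale (\<lambda>\<sigma>. 1 - prob \<xi> \<sigma>) F)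
                               (ie_scale (prob \<xi>) (wpm C X))) ^^ n) ie_zero)"

end

theory Submission
  imports Defs
begin

text \<open>
  Write a class in \<open>\<I>\<E>\<close> as \<open>[(a - b, a + b)]\<close> for two nonnegative expectations \<open>a\<close> and \<open>b\<close>.
  On such classes the mixed-sign transformer acts on \<open>a\<close> and \<open>b\<close> separately, as the standard
  one: sums and nonnegative scalings respect the decomposition, and so does the limit defining
  the loop, because \<open>wp C\<close> is \<open>\<omega>\<close>-continuous and hence the loop's least fixed point is the limit
  of its Kleene iterates. Taking \<open>a = f\<^sup>+\<close> and \<open>b = f\<^sup>-\<close> gives the claim.
\<close>

definition loop_step :: "('v, 'a) state guard \<Rightarrow> ('v, 'a) prog \<Rightarrow> (('v, 'a) state \<Rightarrow> ennreal) \<Rightarrow>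
    (('v, 'a) state \<Rightarrow> ennreal) \<Rightarrow> ('v, 'a) state \<Rightarrow> ennreal" where
  "loop_step \<xi> C h X = (\<lambda>\<sigma>. ennreal (1 - prob \<xi> \<sigma>) * h \<sigma> + ennreal (prob \<xi> \<sigma>) * wp C X \<sigma>)"

lemma wp_While: "wp (While \<xi> C) h = lfp (loop_step \<xi> C h)"
  by (simp add: loop_step_def[abs_def])

lemma sup_continuous_loop_step:
  assumes "sup_continuous (wp C)"
  shows "sup_continuous (loop_step \<xi> C h)"
  unfolding loop_step_def[abs_def]
  by (intro sup_continuous_fun sup_continuous_add_ennreal sup_continuous_mult_left_ennreal
      sup_continuous_const sup_continuous_applyD[OF assms])

text \<open>Continuity here is in the postexpectation \<open>h\<close>, on which each iterate
  depends at every level. The loop case of \<open>sup_continuous_wp\<close> needs it in this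
  form.\<close>

lemma sup_continuous_loop_iterate:
  assumes "sup_continuous (wp C)"
  shows "sup_continuous (\<lambda>h. (loop_step \<xi> C h ^^ n) bot)"
proof (induction n)
  case 0
  then show ?case by (simp add: sup_continuous_const)
next
  case (Suc n)
  have "sup_continuous (\<lambda>h. wp C ((loop_step \<xi> C h ^^ n) bot))"
    using assms Suc by (rule sup_continuous_compose)
  then have "sup_continuous (\<lambda>h. wp C ((loop_step \<xi> C h ^^ n) bot) \<sigma>)" for \<sigma>
    by (rule sup_continuous_applyD)
  then have "sup_continuous (\<lambda>h. loop_step \<xi> C h ((loop_step \<xi> C h ^^ n) bot))"
    by (subst loop_step_def) (intro sup_continuous_fun sup_continuous_add_ennreal
        sup_continuous_mult_left_ennreal sup_continuous_apply)
  then show ?case by (simp only: funpow.simps comp_apply)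
qed

lemma sup_continuous_wp: "sup_continuous (wp C)"
proof (induction C)
  case Skip
  show ?case by (simp add: sup_continuous_def)
next
  case (Assign x E)
  show ?case by (auto simp: sup_continuous_def image_comp fun_eq_iff)
next
  case (Seq C1 C2)
  then show ?case by (simp add: sup_continuous_compose)
next
  case (Cond \<xi> C1 C2)
  show ?case
    unfolding wp.simps[abs_def]
    by (intro sup_continuous_fun sup_continuous_add_ennreal sup_continuous_mult_left_ennreal
        Cond[THEN sup_continuous_applyD])
next
  case (While \<xi> C)
  \<comment> \<open>Kleene's theorem for each fixed \<open>h\<close>; as functions of
    \<open>h\<close>, the iterates then have a supremum that inherits their continuity.\<close>
  have "wp (While \<xi> C) = (SUP n. (\<lambda>h. (loop_step \<xi> C h ^^ n) bot))"
    by (intro ext)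
      (simp only: wp_While sup_continuous_lfp[OF sup_continuous_loop_step[OF While]] SUP_apply)
  moreover have "sup_continuous (SUP n. (\<lambda>h. (loop_step \<xi> C h ^^ n) bot))"
    by (intro sup_continuous_SUP sup_continuous_loop_iterate While)
  ultimately show ?case by (simp only:)
qed

text \<open>The Kleene iterates increase, so their supremum is also their limit, the form in which
  \<open>ie_tendsto\<close> speaks of loops.\<close>

lemma loop_iterates_tendsto_wp: "(\<lambda>n. (loop_step \<xi> C h ^^ n) bot \<sigma>) \<longlonglongrightarrow> wp (While \<xi> C) h \<sigma>"
proof -
  note cont = sup_continuous_loop_step[OF sup_continuous_wp, of \<xi> C h]
  have "wp (While \<xi> C) h \<sigma> = (SUP n. (loop_step \<xi> C h ^^ n) bot \<sigma>)"
    unfolding wp_While sup_continuous_lfp[OF cont] by (simp add: image_comp)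
  moreover have "incseq (\<lambda>n. (loop_step \<xi> C h ^^ n) bot \<sigma>)"
    using mono_funpow[OF sup_continuous_mono[OF cont]] by (auto simp: mono_def le_fun_def)
  ultimately show ?thesis
    by (simp add: LIMSEQ_SUP)
qed

text \<open>
  Where \<open>a\<close> or \<open>b\<close> is infinite, \<open>enn2real\<close> returns the junk value \<open>0\<close>; the class does not depend
  on the first component there.
\<close>

definition diff_pair :: "('s \<Rightarrow> ennreal) \<Rightarrow> ('s \<Rightarrow> ennreal) \<Rightarrow> 's epair" where
  "diff_pair a b = (\<lambda>\<sigma>. enn2real (a \<sigma>) - enn2real (b \<sigma>), \<lambda>\<sigma>. a \<sigma> + b \<sigma>)"

lemma iw_pair_diff_pair: "iw_pair (diff_pair a b)"
  unfolding iw_pair_def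
proof
  fix \<sigma>
  show "ennreal \<bar>fst (diff_pair a b) \<sigma>\<bar> \<le> snd (diff_pair a b) \<sigma>"
    by (cases "a \<sigma>"; cases "b \<sigma>") (auto simp: diff_pair_def simp flip: ennreal_plus intro!: ennreal_leI)
qed

text \<open>Where \<open>snd P\<close> is infinite the bound on \<open>fst P\<close> is trivial;
  elsewhere \<open>P\<close> and \<open>Q\<close> coincide.\<close>

lemma iw_relI:
  assumes "P \<approx>\<^sub>w Q" "iw_pair Q"
  shows "iw_rel P Q"
proof -
  have "ennreal \<bar>fst P \<sigma>\<bar> \<le> snd P \<sigma>" for \<sigma>
    using assms by (cases "snd P \<sigma> = \<infinity>") (auto simp: epair_equiv_def iw_pair_def)
  with assms show ?thesis by (simp add: iw_rel_def iw_pair_def)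
qed

lift_definition ie_diff :: "('s \<Rightarrow> ennreal) \<Rightarrow> ('s \<Rightarrow> ennreal) \<Rightarrow> 's ie" is diff_pair
  by (simp add: iw_relI iw_pair_diff_pair epair_equiv_def)

lemma ie_zero_eq_ie_diff: "ie_zero = ie_diff bot bot"
  by transfer (rule iw_relI[OF epair_equivI iw_pair_diff_pair]; simp add: diff_pair_def bot_ennreal)

text \<open>First components are compared only where the total sum is finite; there all four terms
  are finite and \<open>enn2real\<close> is additive.\<close>

lemma ie_add_ie_diff: "ie_add (ie_diff a b) (ie_diff c d) = ie_diff (\<lambda>\<sigma>. a \<sigma> + c \<sigma>) (\<lambda>\<sigma>. b \<sigma> + d \<sigma>)"
  by transfer (rule iw_relI[OF epair_equivI iw_pair_diff_pair];
      simp add: diff_pair_def ac_simps enn2real_plus top.not_eq_extremum)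

text \<open>For \<open>h \<ge> 0\<close> the factors \<open>h\<close> and
  \<open>\<bar>h\<bar>\<close> agree; a negative factor would exchange the roles of \<open>a\<close>
  and \<open>b\<close>.\<close>

lemma ie_scale_ie_diff:
  assumes "\<And>\<sigma>. 0 \<le> h \<sigma>"
  shows "ie_scale h (ie_diff a b) = ie_diff (\<lambda>\<sigma>. ennreal (h \<sigma>) * a \<sigma>) (\<lambda>\<sigma>. ennreal (h \<sigma>) * b \<sigma>)"
  using assms
  by transfer (rule iw_relI[OF epair_equivI iw_pair_diff_pair];
      simp add: diff_pair_def distrib_left right_diff_distrib enn2real_mult)

lemma ie_subst_ie_diff: "ie_subst u (ie_diff a b) = ie_diff (\<lambda>\<sigma>. a (u \<sigma>)) (\<lambda>\<sigma>. b (u \<sigma>))"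
  by transfer (rule iw_relI[OF epair_equivI iw_pair_diff_pair]; simp add: diff_pair_def)

lemma ie_tendsto_ie_diff:
  assumes "\<And>\<sigma>. (\<lambda>n. a n \<sigma>) \<longlonglongrightarrow> A \<sigma>" "\<And>\<sigma>. (\<lambda>n. b n \<sigma>) \<longlonglongrightarrow> B \<sigma>"
  shows "ie_tendsto (\<lambda>n. ie_diff (a n) (b n)) (ie_diff A B)"
proof -
  \<comment> \<open>\<open>enn2real\<close> is continuous at finite points. First components must
    converge only where \<open>A + B\<close> is finite, hence where both limits are.\<close>
  have "(\<lambda>n. enn2real (x n)) \<longlonglongrightarrow> enn2real l" if "x \<longlonglongrightarrow> l" "l \<noteq> top" for x and l :: ennreal
    using that by (intro tendsto_enn2real) (auto simp: top.not_eq_extremum)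
  with assms show ?thesis
    by transfer (auto simp: diff_pair_def intro!: tendsto_add tendsto_diff)
qed

text \<open>\<open>a\<close> and \<open>b\<close> are generalized because sequencing applies the
  hypothesis to \<open>wp C2 a\<close> and \<open>wp C2 b\<close>, and loops apply it to the
  iterates.\<close>

lemma wpm_ie_diff: "wpm C (ie_diff a b) = ie_diff (wp C a) (wp C b)"
proof (induction C arbitrary: a b)
  case (Assign x E)
  show ?case by (simp add: ie_subst_ie_diff)
next
  case (Cond \<xi> C1 C2)
  then show ?case
    using prob[of \<xi>] by (simp add: ie_scale_ie_diff ie_add_ie_diff)
next
  case (While \<xi> C)
  let ?\<Psi> = "\<lambda>X. ie_add (ie_scale (\<lambda>\<sigma>. 1 - prob \<xi> \<sigma>) (ie_diff a b)) (ie_scale (prob \<xi>) (wpm C X))"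
  have iterates: "(?\<Psi> ^^ n) ie_zero
      = ie_diff ((loop_step \<xi> C a ^^ n) bot) ((loop_step \<xi> C b ^^ n) bot)" for n
  proof (induction n)
    case (Suc n)
    then show ?case
      using prob[of \<xi>] by (simp add: While ie_scale_ie_diff ie_add_ie_diff loop_step_def)
  qed (simp only: funpow.simps id_apply ie_zero_eq_ie_diff)
  have "ie_tendsto (\<lambda>n. (?\<Psi> ^^ n) ie_zero) (ie_diff (wp (While \<xi> C) a) (wp (While \<xi> C) b))"
    unfolding iterates by (intro ie_tendsto_ie_diff loop_iterates_tendsto_wp)
  then show ?case
    unfolding wpm.simps ie_lim_def by (blast intro: the_equality ie_tendsto_unique)
qed simp_all

theorem theorem6:
  fixes C :: "('v, 'a) prog"
    and f f' :: "('v, 'a) state \<Rightarrow> real"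
    and g' :: "('v, 'a) state \<Rightarrow> ennreal"
    and \<sigma> :: "('v, 'a) state"
  assumes "wp C (\<lambda>\<tau>. ennreal \<bar>f \<tau>\<bar>) \<sigma> < \<infinity>"
    and "iw_pair (f', g')"
    and "wpm C (ie_class (f, \<lambda>\<tau>. ennreal \<bar>f \<tau>\<bar>)) = ie_class (f', g')"
  shows "ereal (f' \<sigma>) =
           enn2ereal (wp C (\<lambda>\<tau>. ennreal (max 0 (f \<tau>))) \<sigma>)
           - enn2ereal (wp C (\<lambda>\<tau>. ennreal (- min 0 (f \<tau>))) \<sigma>)"
proof -
  let ?a = "\<lambda>\<tau>. ennreal (max 0 (f \<tau>))" and ?b = "\<lambda>\<tau>. ennreal (- min 0 (f \<tau>))"
  have mono: "mono (wp C)"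
    by (rule sup_continuous_mono[OF sup_continuous_wp])
  \<comment> \<open>Both parts of \<open>f\<close> lie below \<open>\<bar>f\<bar>\<close>, so
    finiteness at \<open>\<sigma>\<close> passes to them by monotonicity.\<close>
  have "wp C ?a \<sigma> \<le> wp C (\<lambda>\<tau>. ennreal \<bar>f \<tau>\<bar>) \<sigma>"
    by (rule le_funD[OF monoD[OF mono]]) (auto simp: le_fun_def intro!: ennreal_leI)
  moreover have "wp C ?b \<sigma> \<le> wp C (\<lambda>\<tau>. ennreal \<bar>f \<tau>\<bar>) \<sigma>"
    by (rule le_funD[OF monoD[OF mono]]) (auto simp: le_fun_def intro!: ennreal_leI)
  ultimately have fin: "wp C ?a \<sigma> < top" "wp C ?b \<sigma> < top"
    using assms(1) by (auto intro: le_less_trans)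
  \<comment> \<open>The two parts have difference \<open>f\<close> and sum
    \<open>\<bar>f\<bar>\<close>; both are finite, so this is an equality of pairs, not only of
    classes.\<close>
  have "(f, \<lambda>\<tau>. ennreal \<bar>f \<tau>\<bar>) = diff_pair ?a ?b"
    by (auto simp: diff_pair_def fun_eq_iff max_def min_def)
  then have "ie_class (diff_pair (wp C ?a) (wp C ?b)) = ie_class (f', g')"
    using assms(3) wpm_ie_diff[of C ?a ?b] by (simp add: ie_diff.abs_eq)
  \<comment> \<open>The quotient is partial: equal classes yield related pairs only when both pairs
    satisfy \<open>iw_pair\<close>.\<close>
  then have "diff_pair (wp C ?a) (wp C ?b) \<approx>\<^sub>w (f', g')"
    using Quotient3_rel[OF Quotient3_ie, of "diff_pair (wp C ?a) (wp C ?b)" "(f', g')"] assms(2)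
    by (simp add: iw_rel_def epair_equiv_def iw_pair_diff_pair)
  then have "f' \<sigma> = enn2real (wp C ?a \<sigma>) - enn2real (wp C ?b \<sigma>)"
    using fin by (auto dest!: fst_eq_of_equiv[of _ _ \<sigma>] simp: diff_pair_def)
  \<comment> \<open>Both values are finite at \<open>\<sigma>\<close>, so the extended difference is
    an ordinary real one.\<close>
  moreover have "enn2ereal x = ereal (enn2real x)" if "x < top" for x :: ennreal
    using that by (cases x) (auto simp: enn2ereal_ennreal)
  ultimately show ?thesis
    using fin by simp
qed

end
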